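(* Let $A=(s_{ij})$ be a symmetric $3\times 3$ real matrix with $s_{11}=s_{22}=s_{33}=0$ and $s_{ij}\ge 0$ for all $i\ne j$. Put $d_1=s_{21}-s_{32}+s_{31}$, $d_2=s_{21}+s_{32}-s_{31}$, $d_3=-s_{21}+s_{32}+s_{31}$. Suppose that $s_{ij}=0$ for some $i\neq j$ or $d_j=0$ for some $j$. Then, up to a permutation of the variables (that is, after replacing $s_{ij}$ by $s_{\sigma(i)\sigma(j)}$ and $d_j$ by $d_{\sigma(j)}$ for some permutation $\sigma$ of $\{1,2,3\}$), one of the following cases holds for the tropical conic $\mathcal{C}(A)$: 1. $s_{21}>0$, $s_{32}>0$, $s_{31}=0$, $d_1>0$, $d_2>0$ and $d_3<0$. 2. $s_{21}>0$, $s_{32}=s_{31}=0$, $d_1>0$, $d_2>0$ and $d_3<0$. 3. $s_{21}=s_{32}=s_{31}=0$ (equivalently, $d_1=d_2=d_3=0$; or, yet equivalently, $d_3=s_{32}=s_{31}=0$), and $\mathcal{C}(A)$ is a double tropical line. 4. $s_{21}>0$, $s_{32}>0$, $s_{31}>0$, $d_1>0$, $d_2>0$ and $d_3=0$, and $\mathcal{C}(A)$ is a pair of tropical lines. 5. $s_{21}>0$, $s_{32}=0$, $s_{31}>0$, $d_1>0$ and $d_2=d_3=0$, and $\mathcal{C}(A)$ is a pair of tropical lines.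
   Context: $\mathbb{T}=\mathbb{R}\cup\{-\infty\}$. The tropical projective plane $\mathbb{T}\mathbb{P}^2$ is the set of classes $[b_1,b_2,b_3]$ of triples in $\mathbb{T}^3\setminus\{(-\infty,-\infty,-\infty)\}$ under $(b_1,b_2,b_3)\sim(b_1+\lambda,b_2+\lambda,b_3+\lambda)$, $\lambda\in\mathbb{R}$. For a symmetric matrix $A=(s_{ij})$ with zero diagonal, the tropical conic $\mathcal{C}(A)$ is the set of points $[X,Y,Z]\in\mathbb{T}\mathbb{P}^2$ at which the maximum $\max\{2X,2Y,2Z,s_{21}+X+Y,s_{32}+Y+Z,s_{31}+X+Z\}$ is attained by at least two of the six terms. A tropical line is the set of points $[X,Y,Z]\in\mathbb{T}\mathbb{P}^2$ at which $\max\{\alpha+X,\beta+Y,\gamma+Z\}$ is attained at least twice, for some $\alpha,\beta,\gamma\in\mathbb{R}$. A pair of tropical lines is a union of two tropical lines (which may coincide). A double tropical line is a conic which, as a set, is a tropical line, all of whose edges have multiplicity two; the multiplicity of an edge $e$ of the conic is the lattice length of the convex hull of the exponent vectors of those terms of the polynomial that attain the maximum at the points of the relative interior of $e$. *)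

theory Defs
  imports "HOL-Analysis.Analysis"
begin

text \<open>
  The tropical semiring \<open>\<real> \<union> {-\<infinity>}\<close> is the set of extended reals different from \<open>\<infinity>\<close>.
  A point of the tropical projective plane is an equivalence class, i.e. a set of triples.
\<close>

definition trop_triples :: "(ereal^3) set" where
  "trop_triples = {x. (\<forall>i. x $ i \<noteq> \<infinity>) \<and> (\<exists>i. x $ i \<noteq> -\<infinity>)}"

definition trop_rel :: "((ereal^3) \<times> (ereal^3)) set" where
  "trop_rel = {(x, y). x \<in> trop_triples \<and> y \<in> trop_triples \<and>
                       (\<exists>l::real. y = (\<chi> i. x $ i + ereal l))}"

definition TP2 :: "(ereal^3) set set" where
  "TP2 = trop_triples // trop_rel"

text \<open>
  A tropical polynomial in three variables is a finite set of terms, each an exponent vector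
  together with a real coefficient; distinct terms have distinct exponent vectors.
  In the value of a term, variables with exponent \<open>0\<close> do not contribute even where they are
  \<open>-\<infinity>\<close>, because \<open>0 * -\<infinity> = 0\<close> in \<^typ>\<open>ereal\<close>.
\<close>

type_synonym trop_poly = "((nat^3) \<times> real) set"

definition term_value :: "(nat^3) \<times> real \<Rightarrow> ereal^3 \<Rightarrow> ereal" where
  "term_value t x = ereal (snd t) + (\<Sum>i\<in>UNIV. ereal (real (fst t $ i)) * x $ i)"

definition maximal_terms :: "trop_poly \<Rightarrow> ereal^3 \<Rightarrow> trop_poly" where
  "maximal_terms P x = {t \<in> P. \<forall>u\<in>P. term_value u x \<le> term_value t x}"

text \<open>
  For homogeneous \<open>P\<close> the set of maximal terms does not depend on the representative \<open>x\<close>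
  of the point \<open>p\<close>.
\<close>

definition trop_zeros :: "trop_poly \<Rightarrow> (ereal^3) set set" where
  "trop_zeros P = {p \<in> TP2. \<exists>x\<in>p. 2 \<le> card (maximal_terms P x)}"

definition conic_poly :: "real^3^3 \<Rightarrow> trop_poly" where
  "conic_poly A =
    {(vector [2, 0, 0], 0), (vector [0, 2, 0], 0), (vector [0, 0, 2], 0),
     (vector [1, 1, 0], A $ 2 $ 1), (vector [0, 1, 1], A $ 3 $ 2), (vector [1, 0, 1], A $ 3 $ 1)}"

definition trop_conic :: "real^3^3 \<Rightarrow> (ereal^3) set set" where
  "trop_conic A = trop_zeros (conic_poly A)"

definition line_poly :: "real \<Rightarrow> real \<Rightarrow> real \<Rightarrow> trop_poly" where
  "line_poly \<alpha> \<beta> \<gamma> =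
    {(vector [1, 0, 0], \<alpha>), (vector [0, 1, 0], \<beta>), (vector [0, 0, 1], \<gamma>)}"

definition tropical_line :: "(ereal^3) set set \<Rightarrow> bool" where
  "tropical_line L \<longleftrightarrow> (\<exists>\<alpha> \<beta> \<gamma>. L = trop_zeros (line_poly \<alpha> \<beta> \<gamma>))"

definition pair_of_tropical_lines :: "(ereal^3) set set \<Rightarrow> bool" where
  "pair_of_tropical_lines C \<longleftrightarrow>
     (\<exists>L M. tropical_line L \<and> tropical_line M \<and> C = L \<union> M)"

text \<open>
  Edges are the one-dimensional cells of the polyhedral complex that the terms of the polynomial
  induce on its zero set. They are represented by their preimages in \<open>\<real>\<^sup>3\<close>, which contain the
  direction \<open>(1, 1, 1)\<close>, so that a one-dimensional cell has a preimage of dimension two.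
  Points with a coordinate \<open>-\<infinity>\<close> can only be ends of edges of a conic and so do not lie in
  relative interiors.
\<close>

definition finite_point :: "real^3 \<Rightarrow> ereal^3" where
  "finite_point x = (\<chi> i. ereal (x $ i))"

definition edges :: "trop_poly \<Rightarrow> (real^3) set set" where
  "edges P = {e. aff_dim e = 2 \<and>
     (\<exists>S\<subseteq>P. 2 \<le> card S \<and> e = {x. S \<subseteq> maximal_terms P (finite_point x)})}"

definition lattice_point :: "int^3 \<Rightarrow> real^3" where
  "lattice_point v = (\<chi> i. of_int (v $ i))"

text \<open>
  The lattice length of a segment with a lattice end point is measured in units of the primitive
  lattice vector in its direction.
\<close>

definition has_lattice_length :: "(real^3) set \<Rightarrow> nat \<Rightarrow> bool" where
  "has_lattice_length S m \<longleftrightarrow>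
     (\<exists>a v. Gcd (range (($) v)) = 1 \<and>
        S = closed_segment (lattice_point a) (lattice_point a + real m *\<^sub>R lattice_point v))"

definition edge_has_multiplicity :: "trop_poly \<Rightarrow> (real^3) set \<Rightarrow> nat \<Rightarrow> bool" where
  "edge_has_multiplicity P e m \<longleftrightarrow>
     (\<forall>x\<in>rel_interior e.
        has_lattice_length
          (convex hull ((\<lambda>t. \<chi> i. real (fst t $ i)) ` maximal_terms P (finite_point x))) m)"

text \<open>
  Being a double line depends on the polynomial, which determines the multiplicities, and not
  only on the set \<open>trop_conic A\<close>.
\<close>

definition double_tropical_line :: "real^3^3 \<Rightarrow> bool" where
  "double_tropical_line A \<longleftrightarrow>
     tropical_line (trop_conic A) \<and>
     (\<forall>e\<in>edges (conic_poly A). edge_has_multiplicity (conic_poly A) e 2)"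

definition dvec :: "real^3^3 \<Rightarrow> real^3" where
  "dvec A = vector [ A $ 2 $ 1 - A $ 3 $ 2 + A $ 3 $ 1,
                     A $ 2 $ 1 + A $ 3 $ 2 - A $ 3 $ 1,
                    - A $ 2 $ 1 + A $ 3 $ 2 + A $ 3 $ 1]"

end

theory Submission
  imports Defs
begin

text \<open>
  The key observation is that \<open>d\<^sub>j = 0\<close> for some \<open>j\<close> means that the entries of \<open>A\<close> are the
  distances \<open>\<bar>c\<^sub>i - c\<^sub>j\<bar>\<close> of three points on the real line. In that case the polynomial of the conic
  is the tropical product of the linear forms \<open>max\<^sub>i (c\<^sub>i + X\<^sub>i)\<close> and \<open>max\<^sub>i (X\<^sub>i - c\<^sub>i)\<close>, its maximal
  terms at any point are the products of maximal terms of the two factors, and the conic is the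
  union of the two lines. If \<open>A = 0\<close>, the two factors coincide.
\<close>

section \<open>Maximisers of functions and of tropical products\<close>

definition argmax_set :: "('a \<Rightarrow> 'b::linorder) \<Rightarrow> 'a set" where
  "argmax_set F = {i. \<forall>k. F k \<le> F i}"

lemma argmax_setI: "(\<And>k. F k \<le> F i) \<Longrightarrow> i \<in> argmax_set F"
  by (simp add: argmax_set_def)

lemma argmax_setD: "i \<in> argmax_set F \<Longrightarrow> F k \<le> F i"
  by (simp add: argmax_set_def)

lemma argmax_set_nonempty:
  fixes F :: "'a::finite \<Rightarrow> 'b::linorder"
  shows "argmax_set F \<noteq> {}"
proof -
  have "Max (range F) \<in> range F"
    by (intro Max_in) auto
  then obtain i where "Max (range F) = F i"
    by (rule rangeE)
  then have "i \<in> argmax_set F"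
    by (metis Max_ge argmax_setI finite finite_imageI rangeI)
  then show ?thesis
    by blast
qed

lemma argmax_set_eqI:
  "i \<in> argmax_set F \<Longrightarrow> F i \<le> F j \<Longrightarrow> j \<in> argmax_set F"
  by (meson argmax_setD argmax_setI order_trans)

lemma two_le_card_iff:
  "finite S \<Longrightarrow> 2 \<le> card S \<longleftrightarrow> (\<exists>a\<in>S. \<exists>b\<in>S. a \<noteq> b)"
  using card_le_Suc0_iff_eq[of S] by (auto simp: not_le numeral_2_eq_2 Suc_le_eq)

text \<open>Adding a weak inequality to a strict one can lose strictness in \<open>ereal\<close> at
  infinite values. Only the larger sides are taken finite, since smaller terms may well be
  \<open>-\<infinity>\<close>.\<close>

lemma ereal_add_less_of_less_of_le:
  fixes a b c d :: ereal
  assumes "a < b" "c \<le> d" "\<bar>b\<bar> \<noteq> \<infinity>" "\<bar>d\<bar> \<noteq> \<infinity>"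
  shows "a + c < b + d"
  using assms by (cases a; cases b; cases c; cases d) auto

text \<open>A sum \<open>F m + G n\<close> reaches the maximum \<open>F i + G k\<close> only if both
  summands are maximal: as the maxima are finite, a non-maximal summand makes the sum strictly
  smaller. The pair \<open>(m, n)\<close> competes with both orders of its factors, whence the two
  products in the union.\<close>

lemma argmax_set_product:
  fixes F G :: "'a::finite \<Rightarrow> ereal"
  assumes "\<And>i. i \<in> argmax_set F \<Longrightarrow> \<bar>F i\<bar> \<noteq> \<infinity>" "\<And>i. i \<in> argmax_set G \<Longrightarrow> \<bar>G i\<bar> \<noteq> \<infinity>"
  defines "H \<equiv> \<lambda>(i, j). max (F i + G j) (F j + G i)"
  shows "argmax_set H =
    argmax_set F \<times> argmax_set G \<union> argmax_set G \<times> argmax_set F"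
proof -
  obtain i k where i: "i \<in> argmax_set F" and k: "k \<in> argmax_set G"
    using argmax_set_nonempty by blast
  have le: "H p \<le> F i + G k" for p
    using argmax_setD[OF i] argmax_setD[OF k]
    by (auto simp: H_def split: prod.split intro!: add_mono)
  have strict: "F m + G n < F i + G k" if "m \<notin> argmax_set F \<or> n \<notin> argmax_set G" for m n
  proof (cases "m \<in> argmax_set F")
    case True
    then have "G n < G k"
      using that argmax_set_eqI[OF k] by (meson not_le)
    then show ?thesis
      using ereal_add_less_of_less_of_le[of "G n" "G k" "F m" "F i"] argmax_setD[OF i]
        assms(1)[OF i] assms(2)[OF k]
      by (simp add: add.commute)
  next
    case False
    then have "F m < F i"
      using argmax_set_eqI[OF i] by (meson not_le)
    then show ?thesis
      using ereal_add_less_of_less_of_le[of "F m" "F i" "G n" "G k"] argmax_setD[OF k]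
        assms(1)[OF i] assms(2)[OF k]
      by simp
  qed
  have eq: "F m + G n = F i + G k" if "m \<in> argmax_set F" "n \<in> argmax_set G" for m n
    using that i k by (intro arg_cong2[of _ _ _ _ "(+)"]) (auto intro: antisym argmax_setD)
  have "p \<in> argmax_set H \<longleftrightarrow> H p = F i + G k" for p
  proof
    assume "p \<in> argmax_set H"
    then have "H (i, k) \<le> H p"
      by (rule argmax_setD)
    then show "H p = F i + G k"
      using le[of p] by (auto simp: H_def)
  qed (use le in \<open>auto intro: argmax_setI\<close>)
  moreover have "H (m, n) = F i + G k \<longleftrightarrow>
    m \<in> argmax_set F \<and> n \<in> argmax_set G \<or> n \<in> argmax_set F \<and> m \<in> argmax_set G" (is "_ \<longleftrightarrow> ?R") for m n
  proof
    assume "H (m, n) = F i + G k"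
    then show ?R
      using strict[of m n] strict[of n m] by (auto simp: H_def max_def split: if_splits)
  next
    assume ?R
    then show "H (m, n) = F i + G k"
      using eq[of m n] eq[of n m] le[of "(m, n)"] by (auto simp: H_def)
  qed
  ultimately show ?thesis
    by auto
qed

section \<open>Terms of lines and conics, indexed by variables and pairs of variables\<close>

lemma maximal_terms_range:
  "maximal_terms (range f) x = f ` argmax_set (\<lambda>i. term_value (f i) x)"
  by (auto simp: maximal_terms_def argmax_set_def)

lemma trop_triples_of_mem_TP2: "p \<in> TP2 \<Longrightarrow> x \<in> p \<Longrightarrow> x \<in> trop_triples"
  by (auto simp: TP2_def quotient_def trop_rel_def)

lemma exhaust_distinct_3:
  fixes i j k l :: 3
  assumes "distinct [i, j, k]"
  shows "l = i \<or> l = j \<or> l = k"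
  using assms exhaust_3[of i] exhaust_3[of j] exhaust_3[of k] exhaust_3[of l] by auto

lemma axis_add_axis_eq_iff:
  fixes i j m n :: 3
  shows "axis i (1::nat) + axis j 1 = axis m 1 + axis n 1 \<longleftrightarrow> i = m \<and> j = n \<or> i = n \<and> j = m"
  using exhaust_3[of i] exhaust_3[of j] exhaust_3[of m] exhaust_3[of n]
  by (elim disjE) (simp_all add: vec_eq_iff forall_3 axis_def)

lemma term_value_axis: "term_value (axis i 1, r) x = ereal r + x $ i"
  using exhaust_3[of i]
  by (elim disjE)
    (simp_all add: term_value_def sum_3 axis_def zero_ereal_def[symmetric] one_ereal_def[symmetric])

lemma term_value_axis_add_axis:
  "term_value (axis i 1 + axis j 1, r) x = ereal r + (x $ i + x $ j)"
proof -
  \<comment> \<open>This serves the case \<open>i = j\<close>, where the exponent vector has an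
    entry 2.\<close>
  have "2 * a = a + a" for a :: ereal
    by (cases a) auto
  then show ?thesis
    using exhaust_3[of i] exhaust_3[of j]
    by (elim disjE)
      (simp_all add: term_value_def sum_3 axis_def zero_ereal_def[symmetric] one_ereal_def[symmetric]
        add.commute)
qed

definition linear_term :: "(3 \<Rightarrow> real) \<Rightarrow> 3 \<Rightarrow> (nat^3) \<times> real" where
  "linear_term c i = (axis i 1, c i)"

text \<open>Ordered pairs index each mixed term twice when \<open>A\<close> is symmetric. They are
  used because products of terms of two linear forms are indexed by ordered pairs as well.\<close>

definition quadratic_term :: "real^3^3 \<Rightarrow> 3 \<times> 3 \<Rightarrow> (nat^3) \<times> real" where
  "quadratic_term A = (\<lambda>(i, j). (axis i 1 + axis j 1, A $ i $ j))"

lemma line_poly_eq: "line_poly (c 1) (c 2) (c 3) = range (linear_term c)"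
proof -
  have "vector [1, 0, 0] = (axis 1 1 :: nat^3)" "vector [0, 1, 0] = (axis 2 1 :: nat^3)"
    "vector [0, 0, 1] = (axis 3 1 :: nat^3)"
    by (simp_all add: vec_eq_iff forall_3 axis_def)
  then show ?thesis
    by (auto simp: line_poly_def linear_term_def UNIV_3)
qed

lemma conic_poly_eq:
  assumes sym: "\<And>i j. A $ i $ j = A $ j $ i" and diag: "\<And>i. A $ i $ i = 0"
  shows "conic_poly A = range (quadratic_term A)"
proof -
  have "vector [2, 0, 0] = (axis 1 1 + axis 1 1 :: nat^3)"
    "vector [0, 2, 0] = (axis 2 1 + axis 2 1 :: nat^3)"
    "vector [0, 0, 2] = (axis 3 1 + axis 3 1 :: nat^3)"
    "vector [1, 1, 0] = (axis 2 1 + axis 1 1 :: nat^3)"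
    "vector [0, 1, 1] = (axis 3 1 + axis 2 1 :: nat^3)"
    "vector [1, 0, 1] = (axis 3 1 + axis 1 1 :: nat^3)"
    by (simp_all add: vec_eq_iff forall_3 axis_def)
  then have "conic_poly A = quadratic_term A ` {(1,1), (2,2), (3,3), (2,1), (3,2), (3,1)}"
    by (simp add: conic_poly_def quadratic_term_def diag)
  moreover have "quadratic_term A (i, j) = quadratic_term A (j, i)" for i j
    by (simp add: quadratic_term_def sym add.commute)
  then have "range (quadratic_term A) =
      quadratic_term A ` {(1,1), (2,2), (3,3), (2,1), (3,2), (3,1)}"
    unfolding UNIV_Times_UNIV[symmetric] UNIV_3 by auto
  ultimately show ?thesis
    by simp
qed

lemma maximal_terms_line:
  "maximal_terms (range (linear_term c)) x =
    linear_term c ` argmax_set (\<lambda>i. ereal (c i) + x $ i)"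
  by (simp add: maximal_terms_range linear_term_def term_value_axis del: One_nat_def)

section \<open>Conics that split into two lines\<close>

text \<open>The number \<open>\<bar>c i - c j\<bar>\<close> is the maximum of
  \<open>c i - c j\<close> and \<open>c j - c i\<close>, the coefficients of the two products that
  yield the monomial of \<open>(i, j)\<close>. So \<open>argmax_set_product\<close> applies, and
  exchanging \<open>i\<close> and \<open>j\<close> does not change the term.\<close>

lemma maximal_terms_conic_of_abs_diff:
  assumes A: "\<And>i j. A $ i $ j = \<bar>c i - c j\<bar>" and x: "x \<in> trop_triples"
  shows "maximal_terms (range (quadratic_term A)) x =
    quadratic_term A ` (argmax_set (\<lambda>i. ereal (c i) + x $ i) \<times> argmax_set (\<lambda>i. ereal (- c i) + x $ i))"
proof -
  define f where "f b = (\<lambda>i. ereal (b i) + x $ i)" for b :: "3 \<Rightarrow> real"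
  have ninf: "x $ i \<noteq> \<infinity>" for i
    using x by (simp add: trop_triples_def)
  obtain k where k: "x $ k \<noteq> -\<infinity>"
    using x by (auto simp: trop_triples_def)
  \<comment> \<open>A maximal value dominates the one at \<open>k\<close>, where the coordinate is
    finite.\<close>
  have fin: "\<bar>f b i\<bar> \<noteq> \<infinity>" if "i \<in> argmax_set (f b)" for b i
    using argmax_setD[OF that, of k] ninf[of i] ninf[of k] k
    by (cases "x $ i"; cases "x $ k") (auto simp: f_def)
  have "term_value (quadratic_term A (i, j)) x =
      max (f c i + f (\<lambda>i. - c i) j) (f c j + f (\<lambda>i. - c i) i)" for i j
    using ninf[of i] ninf[of j]
    by (cases "x $ i"; cases "x $ j")
      (auto simp: quadratic_term_def term_value_axis_add_axis A f_def max_def abs_real_def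
        simp del: One_nat_def)
  then have "(\<lambda>p. term_value (quadratic_term A p) x) =
      (\<lambda>(i, j). max (f c i + f (\<lambda>i. - c i) j) (f c j + f (\<lambda>i. - c i) i))"
    by auto
  then have "maximal_terms (range (quadratic_term A)) x = quadratic_term A `
      (argmax_set (f c) \<times> argmax_set (f (\<lambda>i. - c i)) \<union> argmax_set (f (\<lambda>i. - c i)) \<times> argmax_set (f c))"
    by (simp add: maximal_terms_range argmax_set_product fin)
  also have "\<dots> = quadratic_term A ` (argmax_set (f c) \<times> argmax_set (f (\<lambda>i. - c i)))"
  proof -
    have "quadratic_term A (i, j) = quadratic_term A (j, i)" for i j
      by (simp add: quadratic_term_def A add.commute abs_minus_commute)
    then show ?thesis
      by (force simp: image_Un intro: image_eqI)
  qed
  finally show ?thesis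
    by (simp add: f_def)
qed

lemma quadratic_term_eqD:
  "quadratic_term A (i, j) = quadratic_term A (m, n) \<Longrightarrow> i = m \<and> j = n \<or> i = n \<and> j = m"
  by (simp add: quadratic_term_def axis_add_axis_eq_iff del: One_nat_def)

text \<open>Two maximal terms of one factor, each times the same maximal term of the other, stay
  distinct by \<open>quadratic_term_eqD\<close>. If each factor has a single maximal term, then so
  does the product.\<close>

lemma trop_conic_of_abs_diff:
  assumes A: "\<And>i j. A $ i $ j = \<bar>c i - c j\<bar>"
  shows "trop_conic A =
    trop_zeros (line_poly (c 1) (c 2) (c 3)) \<union> trop_zeros (line_poly (- c 1) (- c 2) (- c 3))"
proof -
  have "2 \<le> card (maximal_terms (range (quadratic_term A)) x) \<longleftrightarrow>
      2 \<le> card (maximal_terms (range (linear_term c)) x) \<or>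
      2 \<le> card (maximal_terms (range (linear_term (\<lambda>i. - c i))) x)"
    (is "?Q \<longleftrightarrow> ?L \<or> ?M") if "x \<in> trop_triples" for x
  proof -
    define F where "F = argmax_set (\<lambda>i. ereal (c i) + x $ i)"
    define G where "G = argmax_set (\<lambda>i. ereal (- c i) + x $ i)"
    have ne: "F \<noteq> {}" "G \<noteq> {}"
      by (simp_all add: F_def G_def argmax_set_nonempty)
    have inj: "inj (linear_term b)" for b
      by (auto simp: inj_def linear_term_def axis_eq_axis)
    have L: "?L \<longleftrightarrow> (\<exists>i\<in>F. \<exists>j\<in>F. i \<noteq> j)"
      unfolding maximal_terms_line F_def[symmetric] using inj
      by (subst card_image) (auto intro: inj_on_subset simp: two_le_card_iff)
    have M: "?M \<longleftrightarrow> (\<exists>i\<in>G. \<exists>j\<in>G. i \<noteq> j)"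
      unfolding maximal_terms_line G_def[symmetric] using inj
      by (subst card_image) (auto intro: inj_on_subset simp: two_le_card_iff)
    have Q: "?Q \<longleftrightarrow> (\<exists>p\<in>F \<times> G. \<exists>q\<in>F \<times> G. quadratic_term A p \<noteq> quadratic_term A q)"
      unfolding maximal_terms_conic_of_abs_diff[OF A that] F_def[symmetric] G_def[symmetric]
      by (subst two_le_card_iff) auto
    show ?thesis
      unfolding L M Q
    proof (intro iffI; (elim disjE)?)
      assume "\<exists>i\<in>F. \<exists>j\<in>F. i \<noteq> j"
      then obtain i j k where "i \<in> F" "j \<in> F" "i \<noteq> j" "k \<in> G"
        using ne by auto
      then show "\<exists>p\<in>F \<times> G. \<exists>q\<in>F \<times> G. quadratic_term A p \<noteq> quadratic_term A q"
        by (intro bexI[of _ "(i, k)"] bexI[of _ "(j, k)"]) (auto dest: quadratic_term_eqD)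
    next
      assume "\<exists>i\<in>G. \<exists>j\<in>G. i \<noteq> j"
      then obtain i j k where "i \<in> G" "j \<in> G" "i \<noteq> j" "k \<in> F"
        using ne by auto
      then show "\<exists>p\<in>F \<times> G. \<exists>q\<in>F \<times> G. quadratic_term A p \<noteq> quadratic_term A q"
        by (intro bexI[of _ "(k, i)"] bexI[of _ "(k, j)"]) (auto dest: quadratic_term_eqD)
    qed (metis mem_Times_iff prod_eqI)
  qed
  moreover have "conic_poly A = range (quadratic_term A)"
    by (rule conic_poly_eq) (simp_all add: A abs_minus_commute)
  ultimately show ?thesis
    unfolding trop_conic_def trop_zeros_def line_poly_eq[of c] line_poly_eq[of "\<lambda>i. - c i"]
    using trop_triples_of_mem_TP2 by auto
qed

text \<open>Equality in the triangle inequality puts three points on a line with \<open>i\<close>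
  between \<open>j\<close> and \<open>k\<close>: \<open>i\<close> at 0, \<open>j\<close> on its
  right and \<open>k\<close> on its left.\<close>

lemma pair_of_tropical_lines_of_additive:
  fixes A :: "real^3^3" and i j k :: 3
  assumes sym: "\<And>i j. A $ i $ j = A $ j $ i" and diag: "\<And>i. A $ i $ i = 0"
    and nonneg: "\<And>i j. A $ i $ j \<ge> 0"
    and ijk: "distinct [i, j, k]" and add: "A $ j $ k = A $ i $ j + A $ i $ k"
  shows "pair_of_tropical_lines (trop_conic A)"
proof -
  define c where "c l = (if l = j then A $ i $ j else if l = k then - (A $ i $ k) else 0)" for l
  have "A $ l $ m = \<bar>c l - c m\<bar>" for l m
    using exhaust_distinct_3[OF ijk] ijk add nonneg[of i j] nonneg[of i k] sym[of j i] sym[of k i] sym[of k j] diag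
    by (smt (verit) c_def distinct_length_2_or_more)
  then show ?thesis
    unfolding pair_of_tropical_lines_def tropical_line_def using trop_conic_of_abs_diff by blast
qed

section \<open>Edges and multiplicities for the zero matrix\<close>

text \<open>Convexity gives access to the criterion \<open>convex_rel_interior_iff\<close> for the
  cells on which all variables in \<open>V\<close> are maximal. Every edge will turn out to come
  from a two-element \<open>V\<close>.\<close>

lemma convex_max_cell: "convex {x::real^3. \<forall>i\<in>V. \<forall>k. x $ k \<le> x $ i}"
proof (rule convexI, safe)
  fix x y :: "real^3" and u v :: real and i k
  assume "\<forall>i\<in>V. \<forall>k. x $ k \<le> x $ i" "\<forall>i\<in>V. \<forall>k. y $ k \<le> y $ i" "0 \<le> u" "0 \<le> v" "i \<in> V"
  then show "(u *\<^sub>R x + v *\<^sub>R y) $ k \<le> (u *\<^sub>R x + v *\<^sub>R y) $ i"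
    by (simp add: add_mono mult_left_mono)
qed

text \<open>The indicator \<open>y\<close> of \<open>V\<close> is a point of the cell where only
  \<open>V\<close> is maximal. From a relative interior point \<open>x\<close>, the segment from
  \<open>y\<close> can be prolonged beyond \<open>x\<close> within the cell. If some
  \<open>k\<close> outside \<open>V\<close> were maximal at \<open>x\<close>, the difference of
  coordinates \<open>i\<close> and \<open>k\<close> would fall from 1 at \<open>y\<close> to 0 at
  \<open>x\<close> and be negative beyond.\<close>

lemma argmax_set_rel_interior:
  fixes V :: "3 set"
  assumes x: "x \<in> rel_interior {x::real^3. \<forall>i\<in>V. \<forall>k. x $ k \<le> x $ i}" and V: "V \<noteq> {}"
  shows "argmax_set (($) x) = V"
proof -
  let ?e = "{x::real^3. \<forall>i\<in>V. \<forall>k. x $ k \<le> x $ i}"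
  define y :: "real^3" where "y = (\<chi> i. if i \<in> V then 1 else 0)"
  have "x \<in> ?e"
    using x rel_interior_subset by blast
  then have "V \<subseteq> argmax_set (($) x)"
    by (auto simp: argmax_set_def)
  moreover have "k \<in> V" if k: "k \<in> argmax_set (($) x)" for k
  proof (rule ccontr)
    assume "k \<notin> V"
    obtain i where i: "i \<in> V"
      using V by blast
    have "y \<in> ?e"
      by (auto simp: y_def)
    then obtain t where "t > 1" and t: "(1 - t) *\<^sub>R y + t *\<^sub>R x \<in> ?e"
      using convex_rel_interior_iff[OF convex_max_cell[of V]] x by blast
    have "x $ i = x $ k"
      using k \<open>x \<in> ?e\<close> i by (auto simp: argmax_set_def intro: antisym)
    then show False
      using t i \<open>k \<notin> V\<close> \<open>t > 1\<close> by (auto simp: y_def dest!: bspec[OF _ i] spec[of _ k])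
  qed
  ultimately show ?thesis
    by blast
qed

text \<open>Where all coordinates agree only the diagonal is left, which is the preimage of the
  vertex of the line and too small for an edge.\<close>

lemma aff_dim_max_cell_UNIV: "aff_dim {x::real^3. \<forall>i\<in>UNIV. \<forall>k. x $ k \<le> x $ i} \<le> 1"
proof -
  have "{x::real^3. \<forall>i\<in>UNIV. \<forall>k. x $ k \<le> x $ i} \<subseteq> span {1}"
  proof
    fix x :: "real^3" assume "x \<in> {x. \<forall>i\<in>UNIV. \<forall>k. x $ k \<le> x $ i}"
    then have "x = x $ 1 *\<^sub>R 1"
      by (auto simp: vec_eq_iff intro: antisym)
    then show "x \<in> span {1}"
      by (metis span_base span_mul singletonI scalar_mult_eq_scaleR)
  qed
  then have "aff_dim {x::real^3. \<forall>i\<in>UNIV. \<forall>k. x $ k \<le> x $ i} \<le> aff_dim (span {1::real^3})"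
    by (rule aff_dim_subset)
  also have "\<dots> \<le> 1"
    by (simp add: aff_dim_subspace dim_insert)
  finally show ?thesis .
qed

text \<open>Of the exponent vectors, the mixed one is the midpoint of the two squares and drops out
  of the hull. The direction from one square to the other is twice a vector with an entry 1, which
  is therefore primitive.\<close>

lemma has_lattice_length_two:
  fixes i j :: 3
  assumes "i \<noteq> j"
  shows "has_lattice_length
    (convex hull ((\<lambda>p. axis (fst p) 1 + axis (snd p) 1) ` ({i, j} \<times> {i, j}))) 2"
  unfolding has_lattice_length_def
proof (intro exI conjI)
  let ?a = "axis i 2 :: int^3" and ?v = "axis j 1 - axis i 1 :: int^3"
  have "?v $ j = 1"
    using assms by (simp add: axis_def)
  then show "Gcd (range (($) ?v)) = 1"
    by (metis Gcd_eq_1_I dvd_refl rangeI)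
  let ?p = "axis i 1 + axis i 1 :: real^3" and ?q = "axis j 1 + axis j 1 :: real^3"
  have pq: "lattice_point ?a = ?p" "?p + real 2 *\<^sub>R lattice_point ?v = ?q"
    by (auto simp: lattice_point_def vec_eq_iff axis_def)
  have mid: "axis i 1 + axis j 1 = midpoint ?p ?q" "axis j 1 + axis i 1 = midpoint ?p ?q"
    by (simp_all add: midpoint_def vec_eq_iff axis_def)
  have "{i, j} \<times> {i, j} = {(i, j), (j, i), (i, i), (j, j)}"
    by auto
  then have "(\<lambda>p. axis (fst p) 1 + axis (snd p) 1 :: real^3) ` ({i, j} \<times> {i, j}) = {midpoint ?p ?q, ?p, ?q}"
    by (simp only: image_insert image_empty fst_conv snd_conv mid insert_absorb2)
  then have "convex hull ((\<lambda>p. axis (fst p) 1 + axis (snd p) 1 :: real^3) ` ({i, j} \<times> {i, j}))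
      = convex hull (insert (midpoint ?p ?q) {?p, ?q})"
    by simp
  also have "\<dots> = convex hull {?p, ?q}"
    by (rule hull_redundant) (simp add: segment_convex_hull[symmetric])
  finally show "convex hull ((\<lambda>p. axis (fst p) 1 + axis (snd p) 1) ` ({i, j} \<times> {i, j})) =
    closed_segment (lattice_point ?a) (lattice_point ?a + real 2 *\<^sub>R lattice_point ?v)"
    by (simp only: pq segment_convex_hull)
qed

lemma maximal_terms_conic_zero:
  "maximal_terms (range (quadratic_term 0)) (finite_point x) =
    quadratic_term 0 ` (argmax_set (($) x) \<times> argmax_set (($) x))"
proof -
  have "finite_point x \<in> trop_triples"
    by (simp add: trop_triples_def finite_point_def)
  then show ?thesis
    using maximal_terms_conic_of_abs_diff[of 0 "\<lambda>i. 0" "finite_point x"]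
    by (simp add: argmax_set_def finite_point_def)
qed

text \<open>The terms in \<open>S\<close> are all maximal exactly where all variables occurring in
  them are. Two distinct terms involve at least two variables, and three variables would leave only
  the vertex.\<close>

lemma edge_conic_zero:
  assumes "e \<in> edges (range (quadratic_term 0))"
  obtains i j where "i \<noteq> j" "e = {x. \<forall>l\<in>{i, j}. \<forall>k. x $ k \<le> x $ l}"
proof -
  obtain S where dim: "aff_dim e = 2" and S: "S \<subseteq> range (quadratic_term 0)" "2 \<le> card S"
    and e: "e = {x. S \<subseteq> maximal_terms (range (quadratic_term 0)) (finite_point x)}"
    using assms by (auto simp: edges_def)
  obtain T where T: "S = quadratic_term 0 ` T"
    using S(1) by (auto simp: subset_image_iff)
  define V where "V = fst ` T \<union> snd ` T"
  have "S \<subseteq> quadratic_term 0 ` (M \<times> M) \<longleftrightarrow> V \<subseteq> M" for M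
    unfolding T V_def by (force dest!: quadratic_term_eqD)
  then have eV: "e = {x. \<forall>l\<in>V. \<forall>k. x $ k \<le> x $ l}"
    by (auto simp: e maximal_terms_conic_zero argmax_set_def)
  \<comment> \<open>An infinite set has \<open>card\<close> 0, so the bound also yields
    finiteness.\<close>
  have "\<exists>a\<in>S. \<exists>b\<in>S. a \<noteq> b"
    using S(2) two_le_card_iff[of S] by (metis card.infinite not_numeral_le_zero)
  then obtain p q where pq: "p \<in> T" "q \<in> T" "p \<noteq> q"
    unfolding T by auto
  then have "\<exists>i\<in>V. \<exists>j\<in>V. i \<noteq> j"
    unfolding V_def by (metis UnCI imageI prod_eqI)
  then obtain i j where ij: "i \<in> V" "j \<in> V" "i \<noteq> j"
    by blast
  have "V \<noteq> UNIV"
    using dim aff_dim_max_cell_UNIV eV by auto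
  have "l = i \<or> l = j" if "l \<in> V" for l
  proof (rule ccontr)
    assume "\<not> (l = i \<or> l = j)"
    then have "distinct [i, j, l]"
      using ij(3) by auto
    then have "V = UNIV"
      using ij that exhaust_distinct_3 by (metis UNIV_eq_I)
    then show False
      using \<open>V \<noteq> UNIV\<close> by contradiction
  qed
  then have "V = {i, j}"
    using ij by blast
  then show thesis
    using that ij eV by blast
qed

text \<open>In the relative interior of an edge exactly two variables are maximal, and the exponents
  of their ordered products span a segment of lattice length two.\<close>

lemma double_tropical_line_zero: "double_tropical_line 0"
  unfolding double_tropical_line_def
proof (intro conjI ballI)
  show "tropical_line (trop_conic 0)"
    using trop_conic_of_abs_diff[of 0 "\<lambda>i. 0"] by (auto simp: tropical_line_def)
  have poly: "conic_poly 0 = range (quadratic_term 0)"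
    by (rule conic_poly_eq) simp_all
  fix e assume "e \<in> edges (conic_poly 0)"
  then obtain i j where ij: "i \<noteq> j" and e: "e = {x. \<forall>l\<in>{i, j}. \<forall>k. x $ k \<le> x $ l}"
    unfolding poly by (rule edge_conic_zero)
  have exps: "(\<lambda>t. \<chi> l. real (fst t $ l)) ` quadratic_term 0 ` W =
      (\<lambda>p. axis (fst p) 1 + axis (snd p) 1) ` W" for W
    by (auto simp: image_image quadratic_term_def vec_eq_iff axis_def intro!: image_cong)
  show "edge_has_multiplicity (conic_poly 0) e 2"
    unfolding edge_has_multiplicity_def poly maximal_terms_conic_zero
  proof
    fix x assume "x \<in> rel_interior e"
    then have "argmax_set (($) x) = {i, j}"
      unfolding e by (rule argmax_set_rel_interior) simp
    then show "has_lattice_length (convex hull ((\<lambda>t. \<chi> i. real (fst t $ i)) `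
        quadratic_term 0 ` (argmax_set (($) x) \<times> argmax_set (($) x)))) 2"
      using has_lattice_length_two[OF ij] by (simp only: exps)
  qed
qed

section \<open>Relabelling of indices and the case distinction\<close>

text \<open>This is the defect in the triangle inequality for the side opposite to \<open>i\<close>,
  twice a Gromov product. The uniform formula shows that \<open>dvec\<close> follows permutations of
  the indices.\<close>

lemma dvec_nth:
  assumes sym: "\<And>i j. A $ i $ j = A $ j $ i" and "distinct [i, j, k]"
  shows "dvec A $ i = A $ i $ j + A $ i $ k - A $ j $ k"
  using assms(2) exhaust_3[of i] exhaust_3[of j] exhaust_3[of k]
    sym[of 1 2] sym[of 1 3] sym[of 2 3]
  by (auto simp: dvec_def)

lemma permutation_of_distinct_3:
  fixes i j k :: 3
  assumes "distinct [i, j, k]"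
  obtains \<sigma> where "\<sigma> permutes UNIV" "\<sigma> 1 = i" "\<sigma> 2 = j" "\<sigma> 3 = k"
proof
  let ?\<sigma> = "\<lambda>l::3. if l = 1 then i else if l = 2 then j else k"
  have "inj ?\<sigma>"
    using assms unfolding inj_def by (metis (full_types) distinct_length_2_or_more exhaust_3)
  then show "?\<sigma> permutes UNIV"
    by (intro bij_imp_permutes bijI finite_UNIV_inj_surj) auto
qed simp_all

theorem theorem2:
  fixes A :: "real^3^3"
  assumes "transpose A = A"
    and "\<forall>i. A $ i $ i = 0"
    and "\<forall>i j. i \<noteq> j \<longrightarrow> A $ i $ j \<ge> 0"
    and "(\<exists>i j. i \<noteq> j \<and> A $ i $ j = 0) \<or> (\<exists>j. dvec A $ j = 0)"
  shows
    "(\<exists>\<sigma>. \<sigma> permutes (UNIV :: 3 set) \<and>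
       (let s = (\<lambda>i j. A $ \<sigma> i $ \<sigma> j); d = (\<lambda>j. dvec A $ \<sigma> j) in
          (s 2 1 > 0 \<and> s 3 2 > 0 \<and> s 3 1 = 0 \<and> d 1 > 0 \<and> d 2 > 0 \<and> d 3 < 0)
        \<or> (s 2 1 > 0 \<and> s 3 2 = 0 \<and> s 3 1 = 0 \<and> d 1 > 0 \<and> d 2 > 0 \<and> d 3 < 0)
        \<or> (s 2 1 = 0 \<and> s 3 2 = 0 \<and> s 3 1 = 0 \<and> double_tropical_line A)
        \<or> (s 2 1 > 0 \<and> s 3 2 > 0 \<and> s 3 1 > 0 \<and> d 1 > 0 \<and> d 2 > 0 \<and> d 3 = 0
             \<and> pair_of_tropical_lines (trop_conic A))
        \<or> (s 2 1 > 0 \<and> s 3 2 = 0 \<and> s 3 1 > 0 \<and> d 1 > 0 \<and> d 2 = 0 \<and> d 3 = 0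
             \<and> pair_of_tropical_lines (trop_conic A))))
   \<and> (\<forall>\<sigma>. \<sigma> permutes (UNIV :: 3 set) \<longrightarrow>
       (let s = (\<lambda>i j. A $ \<sigma> i $ \<sigma> j); d = (\<lambda>j. dvec A $ \<sigma> j) in
          ((s 2 1 = 0 \<and> s 3 2 = 0 \<and> s 3 1 = 0) \<longleftrightarrow> (d 1 = 0 \<and> d 2 = 0 \<and> d 3 = 0))
        \<and> ((s 2 1 = 0 \<and> s 3 2 = 0 \<and> s 3 1 = 0) \<longleftrightarrow> (d 3 = 0 \<and> s 3 2 = 0 \<and> s 3 1 = 0))))"
    (is "(\<exists>\<sigma>. _ \<and> ?cases \<sigma>) \<and> (\<forall>\<sigma>. _ \<longrightarrow> ?equiv \<sigma>)")
proof (intro conjI allI impI)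
  have sym: "A $ i $ j = A $ j $ i" for i j
  proof -
    have "transpose A $ i $ j = A $ j $ i"
      by (simp add: transpose_def)
    then show ?thesis
      using assms(1) by simp
  qed
  have diag: "A $ i $ i = 0" for i
    using assms(2) by simp
  have nonneg: "A $ i $ j \<ge> 0" for i j
    using assms(3) diag by (cases "i = j") auto
  have dvecs: "dvec A $ i = A $ j $ i - A $ k $ j + A $ k $ i"
    "dvec A $ j = A $ j $ i + A $ k $ j - A $ k $ i"
    "dvec A $ k = - (A $ j $ i) + A $ k $ j + A $ k $ i" if "distinct [i, j, k]" for i j k
    using that dvec_nth[OF sym, of i j k] dvec_nth[OF sym, of j i k] dvec_nth[OF sym, of k i j]
      sym[of i j] sym[of i k] sym[of j k] by auto
  \<comment> \<open>Each entry is half the sum of two of the \<open>d\<close>, for example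
    \<open>d 1 + d 2 = 2 * s 2 1\<close>; and \<open>d 3 = - s 2 1\<close> once the other two
    entries vanish.\<close>
  show "?equiv \<sigma>" if "\<sigma> permutes UNIV" for \<sigma>
  proof -
    have "distinct [\<sigma> 1, \<sigma> 2, \<sigma> 3]"
      using permutes_inj[OF that] by (auto simp: inj_eq)
    from dvecs[OF this] show ?thesis
      unfolding Let_def by auto
  qed
  have pair: "pair_of_tropical_lines (trop_conic A)" if "distinct [i, j, k]" "dvec A $ i = 0" for i j k
    using that dvecs(1)[OF that(1)] sym[of j k] sym[of i j] sym[of i k]
    by (intro pair_of_tropical_lines_of_additive[OF sym diag nonneg that(1)]) auto
  have perm: "\<exists>\<sigma>. \<sigma> permutes UNIV \<and> \<sigma> 1 = i \<and> \<sigma> 2 = j \<and> \<sigma> 3 = k" if "distinct [i, j, k]" for i j k :: 3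
    using permutation_of_distinct_3[OF that] by metis
  have third: "\<exists>k. distinct [i, j, k]" if "i \<noteq> j" for i j :: 3
  proof (rule ccontr)
    assume "\<nexists>k. distinct [i, j, k]"
    then show False
      using that by (auto simp: forall_3)
  qed
  \<comment> \<open>With \<open>i, j, k\<close> in the roles of 1, 2, 3, the vanishing entry is
    \<open>s 3 1\<close> and \<open>d 1 = s 2 1 - s 3 2 = - d 3\<close>. A strict inequality gives
    the first or second case, equality the third or fifth.\<close>
  have zero_edge: "\<exists>\<sigma>. \<sigma> permutes UNIV \<and> ?cases \<sigma>"
    if ijk: "distinct [i, j, k]" and z: "A $ k $ i = 0" and le: "A $ k $ j \<le> A $ j $ i" for i j k
  proof -
    consider "A $ j $ i = 0" | "A $ k $ j < A $ j $ i" | "A $ j $ i > 0" "A $ k $ j = A $ j $ i"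
      using le nonneg[of j i] by linarith
    then show ?thesis
    proof cases
      case 1
      then have kj: "A $ k $ j = 0"
        using le nonneg[of k j] by linarith
      have "A $ l $ m = 0" for l m
        using exhaust_distinct_3[OF ijk, of l] exhaust_distinct_3[OF ijk, of m]
          1 z kj sym[of i j] sym[of j k] sym[of i k] diag by auto
      then have "A = 0"
        by (simp add: vec_eq_iff)
      then show ?thesis
        using double_tropical_line_zero by (intro exI[of _ id]) (simp add: permutes_id)
    next
      case 2
      then have "A $ j $ i > 0" "A $ k $ j \<ge> 0"
        using nonneg[of k j] by linarith+
      moreover obtain \<sigma> where "\<sigma> permutes UNIV" "\<sigma> 1 = i" "\<sigma> 2 = j" "\<sigma> 3 = k"
        using perm[OF ijk] by blast
      ultimately show ?thesis
        using 2 z dvecs[OF ijk] by (intro exI[of _ \<sigma>]) (auto simp: Let_def)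
    next
      case 3
      \<comment> \<open>The fifth case has its zero at \<open>s 3 2\<close> instead of
        \<open>s 3 1\<close>, so 1 and 2 trade places.\<close>
      have jik: "distinct [j, i, k]" and ijk': "distinct [i, j, k]"
        using ijk by auto
      obtain \<sigma> where "\<sigma> permutes UNIV" "\<sigma> 1 = j" "\<sigma> 2 = i" "\<sigma> 3 = k"
        using perm[OF jik] by blast
      then show ?thesis
        using 3 z dvecs[OF jik] pair[OF ijk'] sym[of i j] sym[of k j]
        by (intro exI[of _ \<sigma>]) (auto simp: Let_def)
    qed
  qed
  show "\<exists>\<sigma>. \<sigma> permutes UNIV \<and> ?cases \<sigma>"
  proof (cases "\<exists>i j. i \<noteq> j \<and> A $ i $ j = 0")
    case True
    then obtain i k where ik: "i \<noteq> k" "A $ k $ i = 0"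
      using sym by metis
    then obtain j where j: "distinct [i, k, j]"
      using third by blast
    then have ijk: "distinct [i, j, k]" "distinct [k, j, i]"
      by auto
    show ?thesis
    \<comment> \<open>The two ends of the vanishing entry are interchangeable, so the inequality in
      \<open>zero_edge\<close> can be arranged.\<close>
    proof (cases "A $ k $ j \<le> A $ j $ i")
      case True
      then show ?thesis
        by (rule zero_edge[OF ijk(1) ik(2)])
    next
      case False
      then show ?thesis
        using sym[of i j] sym[of j k] sym[of i k] ik(2)
        by (intro zero_edge[OF ijk(2)]) simp_all
    qed
  next
    case False
    then obtain k where k: "dvec A $ k = 0"
      using assms(4) by blast
    obtain i where "i \<noteq> k"
      by (metis zero_neq_one)
    then obtain j where "distinct [k, i, j]"
      using third by metis
    then have ijk: "distinct [i, j, k]" and kij: "distinct [k, i, j]"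
      by auto
    \<comment> \<open>With \<open>k\<close> in the role of 3, \<open>d 3 = 0\<close> turns
      \<open>d 1\<close> and \<open>d 2\<close> into twice \<open>s 3 1\<close> and twice
      \<open>s 3 2\<close>, so positive entries give the fourth case.\<close>
    have pos: "A $ j $ i > 0" "A $ k $ j > 0" "A $ k $ i > 0"
      using False ijk nonneg by (metis distinct_length_2_or_more less_le)+
    obtain \<sigma> where "\<sigma> permutes UNIV" "\<sigma> 1 = i" "\<sigma> 2 = j" "\<sigma> 3 = k"
      using perm[OF ijk] by blast
    then show ?thesis
      using pos k dvecs[OF ijk] pair[OF kij k] by (intro exI[of _ \<sigma>]) (auto simp: Let_def)
  qed
qed

end
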